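(* For every positive integer $n$, \[ \sum_{\pi\in\mathfrak{S}_n} q^{|I(\pi)|}=\sum_{\pi\in\mathfrak{S}_n} q^{|A(\mathrm{runsort}(\pi))|}, \] an identity of polynomials in $q$, where $I(\pi)$ is the set of invisible inversions of $\pi$ and $A(\rho)$ is the set of occurrences of the vincular pattern $13\text{-}2$ in a permutation $\rho$.
   Context: $\mathfrak{S}_n$ is the set of permutations of $[n]=\{1,\dots,n\}$, written in one-line notation. $I(\pi)$ is the set of invisible inversions of $\pi$, i.e. pairs $(i,j)$ such that $i<j$ and $\pi(i)>\pi(j)>i$. An ascending run of $\pi$ is a maximal consecutive increasing subsequence of the one-line notation of $\pi$. $\mathrm{runsort}(\pi)$ is the permutation obtained by rearranging the ascending runs of $\pi$ (and concatenating them) in increasing order of their minimal elements. $A(\rho)$ (denoted $13\text{-}2(\rho)$ in the paper) is the set of pairs $(i,j)$ with $1\le i<j\le n$ such that $\rho(i)<\rho(j)<\rho(i+1)$. *)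

theory Defs
  imports
    "HOL-Combinatorics.Permutations"
    "HOL-Computational_Algebra.Polynomial"
begin

text \<open>
  A permutation of $[n]$ is a function that \<open>permutes {1..n}\<close>; it is the identity
  outside \<open>{1..n}\<close>.
\<close>

definition one_line :: "nat \<Rightarrow> (nat \<Rightarrow> nat) \<Rightarrow> nat list" where
  "one_line n p = map p [1..<Suc n]"

definition invisible_inversions :: "nat \<Rightarrow> (nat \<Rightarrow> nat) \<Rightarrow> (nat \<times> nat) set" where
  "invisible_inversions n p =
     {(i, j). i \<in> {1..n} \<and> j \<in> {1..n} \<and> i < j \<and> p i > p j \<and> p j > i}"

fun ascending_runs :: "'a::linorder list \<Rightarrow> 'a list list" where
  "ascending_runs [] = []"
| "ascending_runs [x] = [[x]]"
| "ascending_runs (x # y # zs) =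
     (let rs = ascending_runs (y # zs)
      in if x < y then (x # hd rs) # tl rs else [x] # rs)"

definition runsort_list :: "'a::linorder list \<Rightarrow> 'a list" where
  "runsort_list xs = concat (sort_key (\<lambda>r. Min (set r)) (ascending_runs xs))"

text \<open>The list index is shifted since list positions start at 0.\<close>

definition runsort :: "nat \<Rightarrow> (nat \<Rightarrow> nat) \<Rightarrow> nat \<Rightarrow> nat" where
  "runsort n p = (\<lambda>i. if i \<in> {1..n} then runsort_list (one_line n p) ! (i - 1) else i)"

definition occurrences_13_2 :: "nat \<Rightarrow> (nat \<Rightarrow> nat) \<Rightarrow> (nat \<times> nat) set" where
  "occurrences_13_2 n r =
     {(i, j). 1 \<le> i \<and> i < j \<and> j \<le> n \<and> r i < r j \<and> r j < r (i + 1)}"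

text \<open>
  \<open>concat_ascending_runs\<close>, \<open>ascending_runs_increasing\<close> and \<open>ascending_runs_maximal\<close>
  together say that \<open>ascending_runs xs\<close> is the decomposition of \<open>xs\<close> into maximal
  increasing blocks of consecutive entries. By \<open>runsort_permutes\<close>, \<open>runsort n p\<close> is again
  a permutation of $[n]$.
\<close>

lemma ascending_runs_eq_Nil_iff [simp]: "ascending_runs xs = [] \<longleftrightarrow> xs = []"
  by (cases xs rule: ascending_runs.cases) (auto simp: Let_def)

lemma concat_ascending_runs: "concat (ascending_runs xs) = xs"
proof (induction xs rule: ascending_runs.induct)
  case (3 x y zs)
  then show ?case
    by (cases "ascending_runs (y # zs)") (auto simp: Let_def)
qed auto

lemma hd_ascending_runs:
  "xs \<noteq> [] \<Longrightarrow> hd (ascending_runs xs) \<noteq> [] \<and> hd (hd (ascending_runs xs)) = hd xs"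
  by (induction xs rule: ascending_runs.induct) (auto simp: Let_def)

lemma ascending_runs_increasing:
  "\<forall>r \<in> set (ascending_runs xs). r \<noteq> [] \<and> sorted_wrt (<) r"
proof (induction xs rule: ascending_runs.induct)
  case (3 x y zs)
  obtain a as where a: "ascending_runs (y # zs) = a # as"
    by (cases "ascending_runs (y # zs)") auto
  have y: "a \<noteq> []" "hd a = y"
    using hd_ascending_runs[of "y # zs"] a by (simp_all del: ascending_runs.simps)
  have IH: "\<forall>r \<in> set (a # as). r \<noteq> [] \<and> sorted_wrt (<) r"
    using 3 unfolding a .
  have "sorted_wrt (<) (x # a)" if "x < y"
  proof -
    obtain b where "a = y # b"
      using y by (cases a) auto
    then show ?thesis
      using IH that by auto
  qed
  moreover have "ascending_runs (x # y # zs) = (if x < y then (x # a) # as else [x] # a # as)"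
    using a by (simp add: Let_def)
  ultimately show ?case
    using IH by simp
qed auto

lemma ascending_runs_maximal:
  "Suc k < length (ascending_runs xs) \<Longrightarrow>
     last (ascending_runs xs ! k) \<ge> hd (ascending_runs xs ! Suc k)"
proof (induction xs arbitrary: k rule: ascending_runs.induct)
  case (3 x y zs)
  obtain a as where a: "ascending_runs (y # zs) = a # as"
    by (cases "ascending_runs (y # zs)") auto
  have y: "a \<noteq> []" "hd a = y"
    using hd_ascending_runs[of "y # zs"] a by (simp_all del: ascending_runs.simps)
  have IH: "last ((a # as) ! l) \<ge> hd ((a # as) ! Suc l)" if "Suc l < length (a # as)" for l
    using 3(1)[of l] that unfolding a .
  have eq: "ascending_runs (x # y # zs) = (if x < y then (x # a) # as else [x] # a # as)"
    using a by (simp add: Let_def)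
  show ?case
    using IH[of k] IH[of "k - 1"] 3(2) y unfolding eq
    by (cases k) (simp_all split: if_splits)
qed auto

lemma mset_runsort_list: "mset (runsort_list xs) = mset xs"
proof -
  have "mset (runsort_list xs) = mset (concat (ascending_runs xs))"
    unfolding runsort_list_def mset_concat by (simp flip: sum_mset_sum_list)
  then show ?thesis
    by (simp add: concat_ascending_runs)
qed

lemma runsort_permutes:
  assumes "p permutes {1..n}"
  shows "runsort n p permutes {1..n}"
proof -
  let ?l = "runsort_list (one_line n p)"
  have set_l: "set ?l = {1..n}"
    using mset_eq_setD[OF mset_runsort_list, of "one_line n p"] permutes_image[OF assms]
    by (simp add: one_line_def atLeastLessThanSuc_atLeastAtMost del: upt_Suc)
  have len: "length ?l = n"
    using mset_eq_length[OF mset_runsort_list, of "one_line n p"] by (simp add: one_line_def)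
  have "runsort n p ` {1..n} = (\<lambda>i. ?l ! (i - 1)) ` Suc ` {..<n}"
    by (auto simp: runsort_def image_Suc_lessThan)
  also have "\<dots> = set ?l"
    using len by (auto simp: image_image set_conv_nth)
  finally have "bij_betw (runsort n p) {1..n} {1..n}"
    using set_l by (simp add: bij_betw_def eq_card_imp_inj_on)
  then show ?thesis
    by (rule bij_imp_permutes) (auto simp: runsort_def)
qed

end

theory Submission
  imports Defs "HOL-Combinatorics.Multiset_Permutations"
begin

text \<open>
  Both statistics are read off from a set of arcs \<open>(a, b)\<close> with \<open>a < b\<close> in which every
  number has at most one outgoing and at most one incoming arc, i.e. from the standard arc
  diagram of a set partition.

  For \<open>\<pi>\<close> on the left-hand side the arcs are the excedances \<open>(i, \<pi> i)\<close>. An invisible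
  inversion \<open>(i, j)\<close> amounts to an arc \<open>(i, \<pi> i)\<close> passing over the value \<open>c = \<pi> j\<close> such
  that any arc arriving at \<open>c\<close> leaves from a number greater than \<open>i\<close>: if no arc arrives
  at \<open>c\<close>, then \<open>j \<ge> c > i\<close> automatically. For \<open>\<pi>\<close> on the right-hand side the arcs are
  the pairs of adjacent entries in a common run. As the runs of \<open>runsort \<pi>\<close> begin with
  increasing minima, an occurrence of 13-2 amounts to an arc \<open>(a, b)\<close> passing over a value
  \<open>c\<close> whose run starts with a greater number than the run of \<open>a\<close>. Both conditions have the
  form of \<open>dominated_pairs\<close>: the source of the arc arriving at \<open>c\<close>, if there is one, has a
  greater key than \<open>a\<close>; the key of a number is the number itself in the first case and the
  start of its run in the second.

  The two arc sets are equidistributed over the permutations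
  (\<open>sum_ascents_eq_sum_excedances\<close>), because inserting a new maximum after \<open>x\<close>, in the word
  or in the cycle of \<open>x\<close>, has the same effect on the arcs. It remains to exchange the two keys
  in a sum over the excedance sets of all permutations. For this, fix the values of the
  permutation at its non-excedances. Then the excedances range over all arc diagrams with a
  given set \<open>S\<close> of sources and a given set \<open>T\<close> of targets. Such a diagram is built by
  processing the targets from left to right: each \<open>t\<close> chooses its source among the \<open>h\<close> numbers
  of \<open>S\<close> below \<open>t\<close> that are not yet connected, and it contributes the rank of the chosen
  source, with respect to the key, among these. Since \<open>h\<close> depends only on \<open>S\<close>, \<open>T\<close> and \<open>t\<close>,
  the generating function is a product of factors \<open>1 + q + \<dots> + q^(h - 1)\<close>, whatever the key
  (\<open>sum_choice_pairs\<close>). A number \<open>c\<close> outside \<open>T\<close> contributes the number of arcs passing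
  over it, which is also determined by \<open>S\<close> and \<open>T\<close> (\<open>card_dominated_pairs\<close>).
\<close>

section \<open>Ascents of words and excedances of permutations\<close>

fun ascents :: "'a::linorder list \<Rightarrow> 'a rel" where
  "ascents [] = {}"
| "ascents [x] = {}"
| "ascents (x # y # zs) = (if x < y then {(x, y)} else {}) \<union> ascents (y # zs)"

definition excedances :: "('a::linorder \<Rightarrow> 'a) \<Rightarrow> 'a rel" where
  "excedances p = {(a, b). b = p a \<and> a < b}"

fun insert_after :: "'a \<Rightarrow> 'a \<Rightarrow> 'a list \<Rightarrow> 'a list" where
  "insert_after x m [] = []"
| "insert_after x m (y # ys) = (if y = x then y # m # ys else y # insert_after x m ys)"

lemma ascents_Cons:
  "ascents (x # xs) = (if xs \<noteq> [] \<and> x < hd xs then {(x, hd xs)} else {}) \<union> ascents xs"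
  by (cases xs) auto

lemma ascents_subset: "ascents w \<subseteq> set w \<times> set w"
  by (induction w rule: ascents.induct) auto

lemma hd_insert_after: "w \<noteq> [] \<Longrightarrow> insert_after x m w \<noteq> [] \<and> hd (insert_after x m w) = hd w"
  by (cases w) auto

lemma set_insert_after: "x \<in> set w \<Longrightarrow> set (insert_after x m w) = insert m (set w)"
  by (induction w) auto

lemma distinct_insert_after:
  "distinct w \<Longrightarrow> x \<in> set w \<Longrightarrow> m \<notin> set w \<Longrightarrow> distinct (insert_after x m w)"
  by (induction w) (auto simp: set_insert_after)

lemma remove1_insert_after:
  "x \<in> set w \<Longrightarrow> m \<notin> set w \<Longrightarrow> remove1 m (insert_after x m w) = w"
  by (induction w) auto

lemma ascents_insert_after:
  assumes "distinct w" "x \<in> set w" "\<forall>y\<in>set w. y < m"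
  shows "ascents (insert_after x m w) = insert (x, m) {e \<in> ascents w. fst e \<noteq> x}"
  using assms
proof (induction w)
  case (Cons y ys)
  show ?case
  proof (cases "y = x")
    case True
    have "{e \<in> ascents ys. fst e \<noteq> x} = ascents ys"
      using ascents_subset[of ys] Cons.prems(1) True by auto
    moreover have "\<not> m < hd ys" if "ys \<noteq> []"
      using Cons.prems(3) that by (meson hd_in_set list.set_intros(2) not_less_iff_gr_or_eq)
    ultimately show ?thesis
      using True Cons.prems(3) by (auto simp: ascents_Cons)
  next
    case False
    then have "ys \<noteq> []" and x: "x \<in> set ys"
      using Cons.prems(2) by auto
    have IH: "ascents (insert_after x m ys) = insert (x, m) {e \<in> ascents ys. fst e \<noteq> x}"
      using Cons x by simp
    show ?thesis
      using False IH hd_insert_after[OF \<open>ys \<noteq> []\<close>] by (auto simp: ascents_Cons)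
  qed
qed simp

lemma ascents_Cons_max: "\<forall>y\<in>set w. y < m \<Longrightarrow> ascents (m # w) = ascents w"
  by (cases w) auto

text \<open>
  A word on \<open>X \<union> {m}\<close> arises from one on \<open>X\<close> by putting \<open>m\<close> after some \<open>x \<in> X\<close> or at
  the front; the choice \<open>x = m\<close> encodes the latter. Likewise for a permutation, whose cycle
  through \<open>x\<close> receives \<open>m\<close> after \<open>x\<close>, or for which \<open>m\<close> becomes a fixed point.
\<close>

definition insert_into_word :: "'a \<Rightarrow> 'a \<Rightarrow> 'a list \<Rightarrow> 'a list" where
  "insert_into_word m x w = (if x = m then m # w else insert_after x m w)"

text \<open>
  The common effect of these insertions on ascents and on excedances when \<open>m\<close> is a new maximum:
  the arc leaving \<open>x\<close>, if any, is redirected to \<open>m\<close>, and the step from \<open>m\<close> to whatever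
  follows is not an ascent.
\<close>

definition insert_into_relation :: "'a \<Rightarrow> 'a \<Rightarrow> 'a rel \<Rightarrow> 'a rel" where
  "insert_into_relation m x P = (if x = m then P else insert (x, m) {e \<in> P. fst e \<noteq> x})"

lemma ascents_insert_into_word:
  assumes "distinct w" "x \<in> insert m (set w)" "\<forall>y\<in>set w. y < m"
  shows "ascents (insert_into_word m x w) = insert_into_relation m x (ascents w)"
  using assms by (cases "x = m") (simp_all add: insert_into_word_def insert_into_relation_def
      ascents_insert_after ascents_Cons_max)

text \<open>
  Injectivity: deleting \<open>m\<close> recovers the old word, and \<open>x\<close> is visible as the source of the
  only ascent ending in \<open>m\<close>. Surjectivity follows by counting.
\<close>

lemma bij_betw_insert_into_word:
  fixes X :: "'a::linorder set"
  assumes "finite X" "\<forall>x\<in>X. x < m"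
  shows "bij_betw (\<lambda>(x, w). insert_into_word m x w)
    (insert m X \<times> permutations_of_set X) (permutations_of_set (insert m X))"
proof -
  let ?f = "\<lambda>(x, w). insert_into_word m x w"
  let ?D = "insert m X \<times> permutations_of_set X"
  have m: "m \<notin> X" using assms by auto
  have perm: "distinct w \<and> set w = X" if "w \<in> permutations_of_set X" for w
    using that by (simp add: permutations_of_set_def)
  have into: "insert_into_word m x w \<in> permutations_of_set (insert m X)"
    if x: "x \<in> insert m X" and w: "w \<in> permutations_of_set X" for x w
  proof (cases "x = m")
    case True
    then show ?thesis using perm[OF w] m by (simp add: permutations_of_set_def insert_into_word_def)
  next
    case False
    then have "x \<in> set w" using x perm[OF w] by simp
    then show ?thesis
      using False perm[OF w] m
      by (simp add: permutations_of_set_def insert_into_word_def set_insert_after distinct_insert_after)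
  qed
  have "inj_on ?f ?D"
  proof (rule inj_onI)
    fix e e' assume e: "e \<in> ?D" and e': "e' \<in> ?D" and eq: "?f e = ?f e'"
    obtain x w where xw: "e = (x, w)" "x \<in> insert m X" "w \<in> permutations_of_set X"
      using e by (cases e) simp
    obtain y v where yv: "e' = (y, v)" "y \<in> insert m X" "v \<in> permutations_of_set X"
      using e' by (cases e') simp
    have eq: "insert_into_word m x w = insert_into_word m y v" using eq xw yv by simp
    have remove: "remove1 m (insert_into_word m z u) = u"
      if "z \<in> insert m X" "u \<in> permutations_of_set X" for z u
      using that perm[of u] m by (cases "z = m") (simp_all add: insert_into_word_def remove1_insert_after)
    have wv: "w = v" using remove[OF xw(2,3)] remove[OF yv(2,3)] eq by simp
    have eqr: "insert_into_relation m x (ascents w) = insert_into_relation m y (ascents w)"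
      using ascents_insert_into_word[of w x m] ascents_insert_into_word[of v y m]
        perm[OF xw(3)] perm[OF yv(3)] xw(2) yv(2) assms(2) eq wv by simp
    have "(z, m) \<notin> ascents w" for z
      using ascents_subset[of w] perm[OF xw(3)] m by blast
    then have max: "(z, m) \<in> insert_into_relation m u (ascents w) \<longleftrightarrow> z = u \<and> u \<noteq> m" for z u
      by (simp add: insert_into_relation_def)
    have "x = y" using max[of x x] max[of x y] max[of y y] max[of y x] eqr by metis
    then show "e = e'" using wv xw yv by simp
  qed
  \<comment> \<open>Both sides have \<open>Suc (card X) * fact (card X)\<close> elements.\<close>
  moreover have "card (permutations_of_set (insert m X)) = card ?D"
    using assms(1) m by (simp add: card_cartesian_product)
  moreover have "?f ` ?D \<subseteq> permutations_of_set (insert m X)"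
    using into by (simp add: image_subset_iff)
  ultimately have "?f ` ?D = permutations_of_set (insert m X)"
    by (intro card_subset_eq) (simp_all add: card_image assms(1))
  with \<open>inj_on ?f ?D\<close> show ?thesis by (simp add: bij_betw_def)
qed

text \<open>
  Composing with this transposition inserts \<open>m\<close> between \<open>x\<close> and \<open>p x\<close> in the cycle of \<open>x\<close>.
\<close>

lemma excedances_transpose:
  fixes X :: "'a::linorder set"
  assumes p: "p permutes X" and X: "\<forall>x\<in>X. x < m" and x: "x \<in> insert m X"
  shows "excedances (transpose m (p x) \<circ> p) = insert_into_relation m x (excedances p)"
proof (cases "x = m")
  case True
  then show ?thesis
    using p X by (auto simp: insert_into_relation_def permutes_not_in)
next
  case False
  with x have x: "x \<in> X" by simp
  have px: "p x \<in> X" "p m = m" "p x < m" "x < m"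
    using p x X by (auto simp: permutes_in_image permutes_def)
  have val: "transpose m (p x) (p a) = (if a = x then m else if a = m then p x else p a)" for a
  proof -
    have "p a = p x \<longleftrightarrow> a = x" "p a = p m \<longleftrightarrow> a = m"
      using permutes_inj[OF p] by (simp_all add: inj_eq)
    then show ?thesis unfolding px(2) transpose_def using px by auto
  qed
  show ?thesis
    unfolding excedances_def insert_into_relation_def using val x px False by auto
qed

text \<open>
  Induction on the maximum of \<open>X\<close>. Because \<open>F\<close> is arbitrary, the induction hypothesis can be
  applied to the sum of \<open>F\<close> over all insertions of \<open>m\<close> into a given set of arcs. This replaces
  an explicit bijection such as the one of Foata.
\<close>

theorem sum_ascents_eq_sum_excedances:
  fixes F :: "'a::linorder rel \<Rightarrow> 'b::comm_monoid_add"
  assumes "finite X"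
  shows "(\<Sum>w\<in>permutations_of_set X. F (ascents w)) = (\<Sum>p | p permutes X. F (excedances p))"
  using assms
proof (induction X arbitrary: F rule: finite_linorder_max_induct)
  case empty
  have "excedances (id :: 'a \<Rightarrow> 'a) = {}" by (auto simp: excedances_def)
  then show ?case by (simp add: id_def)
next
  case (insert m X)
  have m: "m \<notin> X" using insert by auto
  have "(\<Sum>w\<in>permutations_of_set (insert m X). F (ascents w)) =
        (\<Sum>e\<in>insert m X \<times> permutations_of_set X.
          F (ascents (case e of (x, w) \<Rightarrow> insert_into_word m x w)))"
    by (rule sum.reindex_bij_betw[OF bij_betw_insert_into_word[OF insert(1,2)], symmetric])
  also have "\<dots> = (\<Sum>(x, w)\<in>insert m X \<times> permutations_of_set X.
                    F (insert_into_relation m x (ascents w)))"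
  proof (rule sum.cong[OF refl])
    fix e assume "e \<in> insert m X \<times> permutations_of_set X"
    then obtain x w where e: "e = (x, w)" "x \<in> insert m X" "distinct w" "set w = X"
      by (cases e) (simp add: permutations_of_set_def)
    then show "F (ascents (case e of (x, w) \<Rightarrow> insert_into_word m x w)) =
               (case e of (x, w) \<Rightarrow> F (insert_into_relation m x (ascents w)))"
      using ascents_insert_into_word[of w x m] insert(2) by simp
  qed
  also have "\<dots> = (\<Sum>w\<in>permutations_of_set X. \<Sum>x\<in>insert m X.
                    F (insert_into_relation m x (ascents w)))"
    unfolding sum.cartesian_product[symmetric] by (rule sum.swap)
  also have "\<dots> = (\<Sum>p | p permutes X. \<Sum>x\<in>insert m X.
                    F (insert_into_relation m x (excedances p)))"
    by (rule insert.IH)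
  also have "\<dots> = (\<Sum>p | p permutes X. \<Sum>b\<in>insert m X. F (excedances (transpose m b \<circ> p)))"
  proof (rule sum.cong[OF refl])
    fix p assume "p \<in> {p. p permutes X}"
    then have p: "p permutes X" by simp
    then have "p permutes insert m X" by (rule permutes_subset) auto
    then have "bij_betw p (insert m X) (insert m X)" by (rule permutes_imp_bij)
    then have "(\<Sum>b\<in>insert m X. F (excedances (transpose m b \<circ> p))) =
               (\<Sum>x\<in>insert m X. F (excedances (transpose m (p x) \<circ> p)))"
      by (rule sum.reindex_bij_betw[symmetric])
    also have "\<dots> = (\<Sum>x\<in>insert m X. F (insert_into_relation m x (excedances p)))"
      using excedances_transpose[OF p insert(2)] by (intro sum.cong) simp_all
    finally show "(\<Sum>x\<in>insert m X. F (insert_into_relation m x (excedances p))) =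
      (\<Sum>b\<in>insert m X. F (excedances (transpose m b \<circ> p)))" ..
  qed
  also have "\<dots> = (\<Sum>b\<in>insert m X. \<Sum>p | p permutes X. F (excedances (transpose m b \<circ> p)))"
    by (rule sum.swap)
  also have "\<dots> = (\<Sum>p | p permutes insert m X. F (excedances p))"
    using sum_over_permutations_insert[OF insert(1) m, of "\<lambda>p. F (excedances p)"] by simp
  finally show ?case .
qed

section \<open>Arc diagrams with prescribed sources and targets\<close>

text \<open>
  Diagrams with targets \<open>T\<close> and some sources of \<open>S\<close> still unused, as they occur when the targets are
  added in increasing order. If \<open>S\<close> and \<open>T\<close> are finite and equinumerous, no source is left
  (\<open>Domain_arc_diagram\<close>).
\<close>

definition arc_diagrams :: "nat set \<Rightarrow> nat set \<Rightarrow> nat rel set" where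
  "arc_diagrams S T = {P. (\<forall>(a, b)\<in>P. a < b) \<and> Domain P \<subseteq> S \<and> Range P = T \<and>
     single_valued P \<and> single_valued (P\<inverse>)}"

definition open_sources :: "nat set \<Rightarrow> nat rel \<Rightarrow> nat \<Rightarrow> nat set" where
  "open_sources S P t = {s \<in> S. s < t} - Domain P"

text \<open>
  The pairs \<open>(a, c)\<close> where \<open>a\<close> was an unused source when the target \<open>c\<close> chose its own, and
  ranks below the chosen one. A source that is still unused counts as one whose arc ends beyond
  every target so far, so that a pair persists when further arcs are added.
\<close>

definition choice_pairs :: "(nat rel \<Rightarrow> nat \<Rightarrow> nat) \<Rightarrow> nat set \<Rightarrow> nat rel \<Rightarrow> (nat \<times> nat) set" where
  "choice_pairs key S P = {(a, c). a \<in> S \<and> a < c \<and> (\<forall>b. (a, b) \<in> P \<longrightarrow> c < b) \<and>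
     (\<exists>a'. (a', c) \<in> P \<and> key P a < key P a')}"

lemma arc_diagramsD:
  assumes "P \<in> arc_diagrams S T"
  shows "(a, b) \<in> P \<Longrightarrow> a < b" "Domain P \<subseteq> S" "Range P = T"
    "(a, b) \<in> P \<Longrightarrow> (a, b') \<in> P \<Longrightarrow> b = b'" "(a, b) \<in> P \<Longrightarrow> (a', b) \<in> P \<Longrightarrow> a = a'"
  using assms by (auto simp: arc_diagrams_def dest: single_valuedD)

text \<open>
  With \<open>U = UNIV\<close> this serves to count all sources of arcs, with \<open>U = {..<c}\<close> those whose
  arcs end before \<open>c\<close>.
\<close>

lemma bij_betw_targets:
  assumes P: "P \<in> arc_diagrams S T"
  shows "bij_betw (\<lambda>a. THE b. (a, b) \<in> P) {a. \<exists>b\<in>U. (a, b) \<in> P} (T \<inter> U)"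
proof -
  have the: "(THE b. (a, b) \<in> P) = b" if "(a, b) \<in> P" for a b
    using that arc_diagramsD(4)[OF P] by blast
  show ?thesis
    unfolding bij_betw_def inj_on_def
    using the arc_diagramsD(5)[OF P] arc_diagramsD(3)[OF P] by (auto simp: image_iff)
qed

lemma card_sources:
  "P \<in> arc_diagrams S T \<Longrightarrow> card {a. \<exists>b\<in>U. (a, b) \<in> P} = card (T \<inter> U)"
  by (rule bij_betw_same_card[OF bij_betw_targets])

lemma card_Domain_arc_diagram: "P \<in> arc_diagrams S T \<Longrightarrow> card (Domain P) = card T"
  using card_sources[of P S T UNIV] by (simp add: Domain_unfold)

lemma Domain_arc_diagram:
  assumes "P \<in> arc_diagrams S T" "finite S" "card S = card T"
  shows "Domain P = S"
  using assms card_Domain_arc_diagram[of P S T] arc_diagramsD(2)[of P S T]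
  by (simp add: card_subset_eq)

lemma finite_arc_diagrams:
  assumes "finite S" "finite T" shows "finite (arc_diagrams S T)"
  by (rule finite_subset[of _ "Pow (S \<times> T)"]) (use assms in \<open>auto simp: arc_diagrams_def\<close>)

lemma bij_betw_add_arc:
  assumes t: "\<forall>u\<in>T. u < t"
  shows "bij_betw (\<lambda>(P, s). insert (s, t) P)
    (SIGMA P:arc_diagrams S T. open_sources S P t) (arc_diagrams S (insert t T))"
proof (rule bij_betw_byWitness[where f' = "\<lambda>Q. ({(a, b) \<in> Q. b \<noteq> t}, THE s. (s, t) \<in> Q)"])
  have tT: "t \<notin> T" using t by auto
  show "\<forall>x\<in>SIGMA P:arc_diagrams S T. open_sources S P t.
    ({(a, b) \<in> (case x of (P, s) \<Rightarrow> insert (s, t) P). b \<noteq> t},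
     THE s. (s, t) \<in> (case x of (P, s) \<Rightarrow> insert (s, t) P)) = x"
  proof
    fix x assume "x \<in> (SIGMA P:arc_diagrams S T. open_sources S P t)"
    then obtain P s where x: "x = (P, s)" and P: "P \<in> arc_diagrams S T"
      by auto
    have "(a, t) \<notin> P" for a using arc_diagramsD(3)[OF P] tT by auto
    then show "({(a, b) \<in> (case x of (P, s) \<Rightarrow> insert (s, t) P). b \<noteq> t},
      THE s. (s, t) \<in> (case x of (P, s) \<Rightarrow> insert (s, t) P)) = x"
      unfolding x by auto
  qed
  show "\<forall>Q\<in>arc_diagrams S (insert t T).
    (case ({(a, b) \<in> Q. b \<noteq> t}, THE s. (s, t) \<in> Q) of (P, s) \<Rightarrow> insert (s, t) P) = Q"
  proof
    fix Q assume Q: "Q \<in> arc_diagrams S (insert t T)"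
    obtain s where s: "(s, t) \<in> Q" using arc_diagramsD(3)[OF Q] by auto
    then have "(THE s. (s, t) \<in> Q) = s" using arc_diagramsD(5)[OF Q] by blast
    then show "(case ({(a, b) \<in> Q. b \<noteq> t}, THE s. (s, t) \<in> Q) of (P, s) \<Rightarrow> insert (s, t) P) = Q"
      using s arc_diagramsD(5)[OF Q] by auto
  qed
  show "(\<lambda>(P, s). insert (s, t) P) ` (SIGMA P:arc_diagrams S T. open_sources S P t)
    \<subseteq> arc_diagrams S (insert t T)"
    using tT by (auto simp: arc_diagrams_def open_sources_def single_valued_def) 
  show "(\<lambda>Q. ({(a, b) \<in> Q. b \<noteq> t}, THE s. (s, t) \<in> Q)) ` arc_diagrams S (insert t T)
    \<subseteq> (SIGMA P:arc_diagrams S T. open_sources S P t)"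
  proof (rule image_subsetI)
    fix Q assume Q: "Q \<in> arc_diagrams S (insert t T)"
    obtain s where s: "(s, t) \<in> Q" using arc_diagramsD(3)[OF Q] by auto
    then have the: "(THE s. (s, t) \<in> Q) = s" using arc_diagramsD(5)[OF Q] by blast
    have "{(a, b) \<in> Q. b \<noteq> t} \<in> arc_diagrams S T"
      using Q tT by (auto simp: arc_diagrams_def single_valued_def)
    moreover have "s \<in> open_sources S {(a, b) \<in> Q. b \<noteq> t} t"
      using s arc_diagramsD(1,2,4)[OF Q] by (auto simp: open_sources_def)
    ultimately show "({(a, b) \<in> Q. b \<noteq> t}, THE s. (s, t) \<in> Q)
      \<in> (SIGMA P:arc_diagrams S T. open_sources S P t)"
      using the by simp
  qed
qed

text \<open>
  The elements of a finite linearly ordered set have the ranks \<open>0, 1, \<dots>\<close>, each once.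
\<close>

lemma sum_over_ranks:
  fixes key :: "'a \<Rightarrow> 'b::linorder" and f :: "nat \<Rightarrow> 'c::comm_monoid_add"
  assumes "finite A" "inj_on key A"
  shows "(\<Sum>s\<in>A. f (card {a \<in> A. key a < key s})) = (\<Sum>i<card A. f i)"
proof -
  let ?r = "\<lambda>s. card {a \<in> A. key a < key s}"
  have less: "?r s < ?r s'" if "s \<in> A" "s' \<in> A" "key s < key s'" for s s'
    using that assms(1) by (intro psubset_card_mono) auto
  have "inj_on ?r A"
  proof (rule inj_onI)
    fix s s' assume s: "s \<in> A" "s' \<in> A" and eq: "?r s = ?r s'"
    then have "key s = key s'"
      using less[of s s'] less[of s' s] by (cases "key s" "key s'" rule: linorder_cases) simp_all
    then show "s = s'" using assms(2) s by (simp add: inj_on_eq_iff)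
  qed
  moreover have "?r ` A \<subseteq> {..<card A}"
  proof (rule image_subsetI)
    fix s assume "s \<in> A"
    then have "{a \<in> A. key a < key s} \<subset> A" by auto
    then show "?r s \<in> {..<card A}" using assms(1) by (simp add: psubset_card_mono)
  qed
  ultimately have "bij_betw ?r A {..<card A}"
    unfolding bij_betw_def using card_subset_eq[of "{..<card A}" "?r ` A"] card_image[of ?r A]
    by simp
  then show ?thesis by (rule sum.reindex_bij_betw)
qed

text \<open>
  A key may depend on the diagram. The rank of a chosen source must not change when arcs with
  greater targets are added later, and the sources that compete for a target must have distinct keys.
\<close>

locale source_key =
  fixes key :: "nat rel \<Rightarrow> nat \<Rightarrow> nat"
  assumes key_insert: "\<lbrakk>\<forall>(a, b)\<in>P. a < b; a < t\<rbrakk> \<Longrightarrow> key (insert (s, t) P) a = key P a"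
    and key_inj: "\<lbrakk>\<forall>(a, b)\<in>P. a < b; single_valued P\<rbrakk> \<Longrightarrow> inj_on (key P) (- Domain P)"
begin

text \<open>
  Pairs at earlier targets persist, as the new arc ends beyond all of these and the keys below \<open>t\<close>
  stay the same; the pairs at \<open>t\<close> come from the unused sources ranking below \<open>s\<close>.
\<close>

lemma card_choice_pairs_insert:
  assumes P: "P \<in> arc_diagrams S T" and fin: "finite S" "finite T"
    and t: "\<forall>u\<in>T. u < t" and s: "s \<in> open_sources S P t"
  shows "card (choice_pairs key S (insert (s, t) P)) =
    card (choice_pairs key S P) + card {a \<in> open_sources S P t. key P a < key P s}"
proof -
  let ?N = "{a \<in> open_sources S P t. key P a < key P s}"
  note D = arc_diagramsD[OF P]
  have inc: "\<forall>(a, b)\<in>P. a < b" using D(1) by auto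
  have PT: "b < t" if "(a, b) \<in> P" for a b using D(3) t that by auto
  have key: "key (insert (s, t) P) a = key P a" if "a < t" for a
    using key_insert[OF inc that] .
  have st: "s < t" "s \<in> S" "s \<notin> Domain P" using s by (auto simp: open_sources_def)
  have "choice_pairs key S (insert (s, t) P) = choice_pairs key S P \<union> (\<lambda>a. (a, t)) ` ?N"
    (is "?L = ?R")
  proof (rule set_eqI, clarify)
    fix a c
    show "(a, c) \<in> ?L \<longleftrightarrow> (a, c) \<in> ?R"
    proof (cases "c = t")
      case True
      have "(a', t) \<in> insert (s, t) P \<longleftrightarrow> a' = s" for a' using PT by auto
      moreover have "(a, t) \<notin> choice_pairs key S P"
        using PT by (auto simp: choice_pairs_def)
      moreover have "(\<forall>b. (a, b) \<in> insert (s, t) P \<longrightarrow> t < b) \<longleftrightarrow> a \<noteq> s \<and> a \<notin> Domain P"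
        using PT by (auto dest: less_asym)
      ultimately show ?thesis
        using True st key by (auto simp: choice_pairs_def open_sources_def)
    next
      case False
      have "(a, c) \<in> ?L \<longleftrightarrow> (a, c) \<in> choice_pairs key S P"
      proof (cases "c < t")
        case True
        have "key (insert (s, t) P) a = key P a" if "a < c"
          using key that True by simp
        moreover have "key (insert (s, t) P) a' = key P a'" if "(a', c) \<in> P" for a'
          using key D(1)[OF that] True by simp
        ultimately show ?thesis
          using False True by (auto simp: choice_pairs_def)
      next
        case F: False
        then have "(a', c) \<notin> insert (s, t) P" for a' using PT False by auto
        then show ?thesis by (auto simp: choice_pairs_def)
      qed
      then show ?thesis using False by auto
    qed
  qed
  moreover have "choice_pairs key S P \<inter> (\<lambda>a. (a, t)) ` ?N = {}"
    using PT by (auto simp: choice_pairs_def)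
  moreover have "finite (choice_pairs key S P)"
    by (rule finite_subset[of _ "S \<times> T"]) (use D(3) fin in \<open>auto simp: choice_pairs_def\<close>)
  moreover have "finite ?N" using fin by (auto simp: open_sources_def)
  moreover have "card ((\<lambda>a. (a, t)) ` ?N) = card ?N"
    by (rule card_image) (auto simp: inj_on_def)
  ultimately show ?thesis by (simp add: card_Un_disjoint)
qed

text \<open>
  The right-hand side does not mention the key: the number of sources available to the target \<open>t\<close>
  is independent of all previous choices, and so is the set of ranks among which it chooses.
\<close>

lemma sum_choice_pairs:
  assumes "finite T" "finite S"
  shows "(\<Sum>P\<in>arc_diagrams S T. monom (1::'r::comm_semiring_1) (card (choice_pairs key S P))) =
    (\<Prod>t\<in>T. \<Sum>i<card {s \<in> S. s < t} - card {u \<in> T. u < t}. monom 1 i)"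
  using assms
proof (induction T rule: finite_linorder_max_induct)
  case empty
  have "arc_diagrams S {} = {{}}" by (auto simp: arc_diagrams_def)
  then show ?case by (simp add: choice_pairs_def one_pCons monom_0)
next
  case (insert t T)
  let ?m = "\<lambda>k. monom (1::'r) k"
  let ?h = "card {s \<in> S. s < t} - card T"
  have tT: "t \<notin> T" using insert(2) by auto
  have "(\<Sum>Q\<in>arc_diagrams S (insert t T). ?m (card (choice_pairs key S Q))) =
    (\<Sum>(P, s)\<in>(SIGMA P:arc_diagrams S T. open_sources S P t).
       ?m (card (choice_pairs key S (insert (s, t) P))))"
    using bij_betw_add_arc[of T t S] insert(2)
    by (subst sum.reindex_bij_betw[symmetric]) (auto simp: case_prod_beta')
  also have "\<dots> = (\<Sum>P\<in>arc_diagrams S T. \<Sum>s\<in>open_sources S P t.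
       ?m (card (choice_pairs key S (insert (s, t) P))))"
    using insert by (subst sum.Sigma) (auto simp: finite_arc_diagrams open_sources_def)
  also have "\<dots> = (\<Sum>P\<in>arc_diagrams S T. ?m (card (choice_pairs key S P)) * (\<Sum>i<?h. ?m i))"
  proof (rule sum.cong)
    fix P assume P: "P \<in> arc_diagrams S T"
    note D = arc_diagramsD[OF P]
    let ?O = "open_sources S P t"
    have fin: "finite ?O" using insert by (simp add: open_sources_def)
    have "card (Domain P) = card T" by (rule card_Domain_arc_diagram[OF P])
    moreover have "Domain P \<subseteq> {s \<in> S. s < t}"
    proof
      fix a assume "a \<in> Domain P"
      then obtain b where b: "(a, b) \<in> P" by blast
      then have "b \<in> T" using D(3) by blast
      then have "b < t" using insert(2) by blast
      then show "a \<in> {s \<in> S. s < t}" using D(1)[OF b] D(2) b by auto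
    qed
    ultimately have card: "card ?O = ?h"
      unfolding open_sources_def using insert.prems
      by (subst card_Diff_subset) (auto intro: finite_subset)
    have "inj_on (key P) ?O"
      by (rule inj_on_subset[OF key_inj]) (use P in \<open>auto simp: open_sources_def arc_diagrams_def\<close>)
    then have rank: "(\<Sum>s\<in>?O. ?m (card {a \<in> ?O. key P a < key P s})) = (\<Sum>i<?h. ?m i)"
      using sum_over_ranks[OF fin, of "key P" ?m] card by simp
    have "(\<Sum>s\<in>?O. ?m (card (choice_pairs key S (insert (s, t) P)))) =
      (\<Sum>s\<in>?O. ?m (card (choice_pairs key S P)) * ?m (card {a \<in> ?O. key P a < key P s}))"
      using insert P by (intro sum.cong) (auto simp: card_choice_pairs_insert mult_monom)
    then show "(\<Sum>s\<in>?O. ?m (card (choice_pairs key S (insert (s, t) P)))) =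
      ?m (card (choice_pairs key S P)) * (\<Sum>i<?h. ?m i)"
      using rank by (simp flip: sum_distrib_left)
  qed simp
  also have "\<dots> = (\<Prod>u\<in>T. \<Sum>i<card {s \<in> S. s < u} - card {v \<in> T. v < u}. ?m i) * (\<Sum>i<?h. ?m i)"
    using insert by (simp flip: sum_distrib_right)
  also have "\<dots> = (\<Prod>u\<in>insert t T. \<Sum>i<card {s \<in> S. s < u} - card {v \<in> insert t T. v < u}. ?m i)"
  proof -
    have "{v \<in> insert t T. v < t} = T" using insert(2) by auto
    moreover have "{v \<in> insert t T. v < u} = {v \<in> T. v < u}" if "u \<in> T" for u
      using insert(2) that by (auto dest: less_asym)
    ultimately show ?thesis using insert(1) tT by (simp add: mult.commute cong: prod.cong)
  qed
  finally show ?case .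
qed

end

text \<open>
  The statistic that specializes to invisible inversions and to occurrences of 13-2.
\<close>

definition dominated_pairs :: "(nat rel \<Rightarrow> nat \<Rightarrow> nat) \<Rightarrow> nat rel \<Rightarrow> (nat \<times> nat) set" where
  "dominated_pairs key P = {(a, c). \<exists>b. (a, b) \<in> P \<and> a < c \<and> c < b \<and>
     (\<forall>a'. (a', c) \<in> P \<longrightarrow> key P a < key P a')}"

text \<open>
  At a target \<open>c \<in> T\<close> the dominated pairs are the choice pairs. At other numbers \<open>c\<close> every arc
  passing over \<open>c\<close> counts. These arcs belong to the sources below \<open>c\<close> that are not connected to
  one of the targets below \<open>c\<close>.
\<close>

lemma card_dominated_pairs:
  assumes P: "P \<in> arc_diagrams S T" and fin: "finite S" "finite T" and card: "card S = card T"
  shows "card (dominated_pairs key P) = card (choice_pairs key S P) +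
    (\<Sum>c\<in>(\<Union>t\<in>T. {..<t}) - T. card {s \<in> S. s < c} - card {u \<in> T. u < c})"
proof -
  note D = arc_diagramsD[OF P]
  let ?C = "(\<Union>t\<in>T. {..<t}) - T"
  let ?A = "\<lambda>c. {a. \<exists>b. (a, b) \<in> P \<and> a < c \<and> c < b}"
  have dom: "Domain P = S" using Domain_arc_diagram[OF P fin(1) card] .
  have A: "card (?A c) = card {s \<in> S. s < c} - card {u \<in> T. u < c}" if "c \<in> ?C" for c
  proof -
    have "?A c = {s \<in> S. s < c} - {a. \<exists>b\<in>{..<c}. (a, b) \<in> P}"
    proof (rule set_eqI)
      fix a
      have ne: "b \<noteq> c" if "(a, b) \<in> P" for b using that \<open>c \<in> ?C\<close> D(3) by auto
      show "a \<in> ?A c \<longleftrightarrow> a \<in> {s \<in> S. s < c} - {a. \<exists>b\<in>{..<c}. (a, b) \<in> P}"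
      proof (cases "\<exists>b. (a, b) \<in> P")
        case True
        then obtain b where b: "(a, b) \<in> P" by blast
        then have "(a, b') \<in> P \<longleftrightarrow> b' = b" for b' using D(4) by blast
        moreover have "c < b \<longleftrightarrow> \<not> b < c" using ne[OF b] by auto
        moreover have "a \<in> S" using b dom by auto
        ultimately show ?thesis by simp
      qed (use dom in auto)
    qed
    moreover have "{a. \<exists>b\<in>{..<c}. (a, b) \<in> P} \<subseteq> {s \<in> S. s < c}"
      using dom D(1) by (auto intro: less_trans)
    moreover have "T \<inter> {..<c} = {u \<in> T. u < c}" by auto
    ultimately show ?thesis
      using fin card_sources[OF P, of "{..<c}"]
      by (simp add: card_Diff_subset finite_subset)
  qed
  have "dominated_pairs key P = choice_pairs key S P \<union> prod.swap ` (SIGMA c:?C. ?A c)" (is "?L = ?R")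
  proof (rule set_eqI, clarify)
    fix a c
    show "(a, c) \<in> ?L \<longleftrightarrow> (a, c) \<in> ?R"
    proof (cases "c \<in> T")
      case True
      then obtain a' where a': "(a', c) \<in> P" using D(3) by auto
      have "(a'', c) \<in> P \<longleftrightarrow> a'' = a'" for a'' using a' D(5) by auto
      moreover have "(\<exists>b. (a, b) \<in> P \<and> c < b) \<longleftrightarrow> a \<in> S \<and> (\<forall>b. (a, b) \<in> P \<longrightarrow> c < b)"
        using dom D(4) by blast
      ultimately show ?thesis
        using True by (auto simp: dominated_pairs_def choice_pairs_def)
    next
      case False
      then have "(a', c) \<notin> P" for a' using D(3) by auto
      moreover have "c \<in> ?C" if "(a, b) \<in> P" "c < b" for b
        using that False D(3) by auto
      ultimately show ?thesis
        by (auto simp: dominated_pairs_def choice_pairs_def)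
    qed
  qed
  moreover have "choice_pairs key S P \<inter> prod.swap ` (SIGMA c:?C. ?A c) = {}"
    using D(3) by (auto simp: choice_pairs_def)
  moreover have "finite (choice_pairs key S P)"
    by (rule finite_subset[of _ "S \<times> T"]) (use D(3) fin in \<open>auto simp: choice_pairs_def\<close>)
  moreover have finC: "finite ?C" using fin by auto
  moreover have finA: "\<forall>c\<in>?C. finite (?A c)"
    using fin dom by (auto intro: finite_subset[of _ S])
  moreover have "finite (prod.swap ` (SIGMA c:?C. ?A c))" using finC finA by auto
  moreover have "card (prod.swap ` (SIGMA c:?C. ?A c)) = (\<Sum>c\<in>?C. card (?A c))"
    using finC finA by (subst card_image) (auto simp: card_SigmaI)
  ultimately show ?thesis
    using card_Un_disjoint[of "choice_pairs key S P" "prod.swap ` (SIGMA c:?C. ?A c)"] A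
    by simp
qed

lemma sum_dominated_pairs_key_cong:
  assumes "source_key key" "source_key key'" and "finite S" "finite T" "card S = card T"
  shows "(\<Sum>P\<in>arc_diagrams S T. monom (1::'r::comm_semiring_1) (card (dominated_pairs key P))) =
    (\<Sum>P\<in>arc_diagrams S T. monom 1 (card (dominated_pairs key' P)))"
proof -
  let ?d = "\<Sum>c\<in>(\<Union>t\<in>T. {..<t}) - T. card {s \<in> S. s < c} - card {u \<in> T. u < c}"
  let ?R = "\<Prod>t\<in>T. \<Sum>i<card {s \<in> S. s < t} - card {u \<in> T. u < t}. monom (1::'r) i"
  have "(\<Sum>P\<in>arc_diagrams S T. monom (1::'r) (card (dominated_pairs k P))) = ?R * monom 1 ?d"
    if "source_key k" for k
  proof -
    have "(\<Sum>P\<in>arc_diagrams S T. monom (1::'r) (card (dominated_pairs k P))) =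
      (\<Sum>P\<in>arc_diagrams S T. monom 1 (card (choice_pairs k S P)) * monom 1 ?d)"
      using assms by (intro sum.cong refl) (simp add: card_dominated_pairs mult_monom)
    also have "\<dots> = ?R * monom 1 ?d"
      using source_key.sum_choice_pairs[OF that assms(4,3), where 'r = 'r]
      by (simp flip: sum_distrib_right)
    finally show ?thesis .
  qed
  then show ?thesis using assms(1,2) by simp
qed

section \<open>Permutations with prescribed non-excedances\<close>

text \<open>
  The permutations \<open>q\<close> that share with \<open>p\<close> the non-excedances and the values there have the same
  targets of arcs as \<open>p\<close>, because these are the remaining values.
\<close>

lemma excedance_diagram:
  assumes p: "p permutes X" and q: "q permutes X"
    and less: "\<And>a. a < q a \<longleftrightarrow> a < p a" and eq: "\<And>a. \<not> a < p a \<Longrightarrow> q a = p a"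
  shows "excedances q \<in> arc_diagrams {a. a < p a} (p ` {a. a < p a})"
proof -
  let ?S = "{a. a < p a}"
  have "q ` ?S = UNIV - q ` (- ?S)"
    using permutes_inj[OF q] permutes_surj[OF q] by (auto simp: inj_eq image_iff surj_def)
  also have "q ` (- ?S) = p ` (- ?S)" using eq by (intro image_cong) auto
  also have "UNIV - p ` (- ?S) = p ` ?S"
    using permutes_inj[OF p] permutes_surj[OF p] by (auto simp: inj_eq image_iff surj_def)
  finally have "q ` ?S = p ` ?S" .
  moreover have "Range (excedances q) = q ` ?S" using less by (auto simp: excedances_def)
  moreover have "Domain (excedances q) = ?S" using less by (auto simp: excedances_def)
  moreover have "single_valued (excedances q)" "single_valued ((excedances q)\<inverse>)"
    using permutes_inj[OF q] by (auto simp: excedances_def single_valued_def inj_eq)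
  moreover have "\<forall>(a, b)\<in>excedances q. a < b" by (auto simp: excedances_def)
  ultimately show ?thesis by (simp add: arc_diagrams_def)
qed

text \<open>
  As \<open>P\<close> maps its sources bijectively onto the same targets as \<open>p\<close> does, the values of \<open>p\<close> at the
  non-excedances can be kept.
\<close>

lemma excedance_diagram_surj:
  fixes p :: "nat \<Rightarrow> nat"
  assumes p: "p permutes X" and X: "finite X"
    and P: "P \<in> arc_diagrams {a. a < p a} (p ` {a. a < p a})"
  shows "\<exists>q. q permutes X \<and> (\<forall>a. a < q a \<longleftrightarrow> a < p a) \<and> (\<forall>a. \<not> a < p a \<longrightarrow> q a = p a) \<and>
    excedances q = P"
proof -
  let ?S = "{a. a < p a}"
  let ?f = "\<lambda>a. THE b. (a, b) \<in> P"
  let ?q = "\<lambda>a. if a \<in> ?S then ?f a else p a"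
  note D = arc_diagramsD[OF P]
  have SX: "?S \<subseteq> X" using permutes_not_in[OF p] by fastforce
  have finS: "finite ?S" using SX X by (rule finite_subset)
  have "card ?S = card (p ` ?S)"
    by (rule card_image[symmetric]) (rule permutes_inj_on[OF p])
  then have dom: "Domain P = ?S" using Domain_arc_diagram[OF P finS] by simp
  have f: "(a, b) \<in> P \<longleftrightarrow> a \<in> ?S \<and> b = ?f a" for a b
  proof (cases "a \<in> ?S")
    case True
    then obtain b' where b': "(a, b') \<in> P" using dom by blast
    then have "?f a = b'" using D(4) by blast
    then show ?thesis using True b' D(4) by blast
  qed (use dom in blast)
  have "bij_betw ?f ?S (p ` ?S)"
    using bij_betw_targets[OF P, of UNIV] dom by (simp add: Domain_unfold)
  moreover have "bij_betw ?q ?S (p ` ?S) \<longleftrightarrow> bij_betw ?f ?S (p ` ?S)"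
    by (rule bij_betw_cong) simp
  ultimately have "bij_betw ?q ?S (p ` ?S)" by blast
  moreover have "bij_betw p (- ?S) (p ` (- ?S))"
    by (rule bij_betw_imageI[OF permutes_inj_on[OF p] refl])
  moreover have "bij_betw ?q (- ?S) (p ` (- ?S)) \<longleftrightarrow> bij_betw p (- ?S) (p ` (- ?S))"
    by (rule bij_betw_cong) simp
  ultimately have "bij_betw ?q ?S (p ` ?S)" "bij_betw ?q (- ?S) (p ` (- ?S))" by blast+
  moreover have "p ` ?S \<inter> p ` (- ?S) = {}" using permutes_inj[OF p] by (auto simp: inj_eq)
  ultimately have "bij_betw ?q (?S \<union> - ?S) (p ` ?S \<union> p ` (- ?S))" by (rule bij_betw_combine)
  moreover have "p ` ?S \<union> p ` (- ?S) = UNIV"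
    using permutes_surj[OF p] by (simp flip: image_Un)
  ultimately have "bij ?q" by simp
  moreover have "?q a = a" if "a \<notin> X" for a using that SX permutes_not_in[OF p] by auto
  ultimately have "?q permutes X" by (simp add: permutes_def bij_iff)
  moreover have less: "a < ?q a \<longleftrightarrow> a < p a" for a
    using f[of a "?f a"] D(1)[of a "?f a"] by auto
  moreover have "excedances ?q = P"
  proof -
    have "(a, b) \<in> excedances ?q \<longleftrightarrow> (a, b) \<in> P" for a b
      using less[of a] f[of a b] by (auto simp: excedances_def)
    then show ?thesis by auto
  qed
  ultimately show ?thesis by (intro exI[of _ ?q]) auto
qed

text \<open>
  Grouping the permutations by their restriction \<open>low\<close> to the non-excedances turns the sum over
  each group into a sum over all arc diagrams with certain sources and targets.
\<close>

lemma sum_excedances_cong: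
  fixes F G :: "nat rel \<Rightarrow> 'b::comm_monoid_add"
  assumes X: "finite X"
    and eq: "\<And>S T. \<lbrakk>finite S; finite T; card S = card T\<rbrakk> \<Longrightarrow>
      sum F (arc_diagrams S T) = sum G (arc_diagrams S T)"
  shows "(\<Sum>p | p permutes X. F (excedances p)) = (\<Sum>p | p permutes X. G (excedances p))"
proof -
  define low where "low p a = (if a < p a then None else Some (p a))" for p :: "nat \<Rightarrow> nat" and a
  let ?Perm = "{p. p permutes X}"
  have fibre: "(\<Sum>q | q \<in> ?Perm \<and> low q = low p. H (excedances q)) =
      sum H (arc_diagrams {a. a < p a} (p ` {a. a < p a}))"
    if p: "p permutes X" for p and H :: "nat rel \<Rightarrow> 'b"
  proof (rule sum.reindex_bij_betw)
    have low: "low q = low p \<longleftrightarrow> (\<forall>a. a < q a \<longleftrightarrow> a < p a) \<and> (\<forall>a. \<not> a < p a \<longrightarrow> q a = p a)"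
      for q by (auto simp: low_def fun_eq_iff split: if_splits)
    let ?fib = "{q. q \<in> ?Perm \<and> low q = low p}"
    have "inj_on excedances ?fib"
    proof (rule inj_onI)
      fix q q' assume q: "q \<in> ?fib" and q': "q' \<in> ?fib" and exc: "excedances q = excedances q'"
      show "q = q'"
      proof
        fix a
        show "q a = q' a"
        proof (cases "a < p a")
          case True
          then have "(a, q a) \<in> excedances q" using q by (auto simp: low excedances_def)
          then show ?thesis using exc by (auto simp: excedances_def)
        next
          case False
          then show ?thesis using q q' by (simp add: low)
        qed
      qed
    qed
    moreover have "excedances ` ?fib = arc_diagrams {a. a < p a} (p ` {a. a < p a})"
    proof
      show "excedances ` ?fib \<subseteq> arc_diagrams {a. a < p a} (p ` {a. a < p a})"
        using excedance_diagram[OF p] low by (intro image_subsetI) blast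
      show "arc_diagrams {a. a < p a} (p ` {a. a < p a}) \<subseteq> excedances ` ?fib"
      proof
        fix P assume "P \<in> arc_diagrams {a. a < p a} (p ` {a. a < p a})"
        from excedance_diagram_surj[OF p X this] obtain q where
          "q \<in> ?fib" "excedances q = P" using low by blast
        then show "P \<in> excedances ` ?fib" by blast
      qed
    qed
    ultimately show "bij_betw excedances ?fib (arc_diagrams {a. a < p a} (p ` {a. a < p a}))"
      by (simp add: bij_betw_def)
  qed
  have fin: "finite ?Perm" using X by (rule finite_permutations)
  have group: "(\<Sum>p\<in>?Perm. H (excedances p)) =
      (\<Sum>l\<in>low ` ?Perm. \<Sum>q | q \<in> ?Perm \<and> low q = l. H (excedances q))" for H :: "nat rel \<Rightarrow> 'b"
    by (rule sum.group[symmetric]) (use fin in auto)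
  have fibre_eq: "(\<Sum>q | q \<in> ?Perm \<and> low q = low p. F (excedances q)) =
        (\<Sum>q | q \<in> ?Perm \<and> low q = low p. G (excedances q))" if p: "p permutes X" for p
  proof -
    have "{a. a < p a} \<subseteq> X" using permutes_not_in[OF p] by fastforce
    then have "finite {a. a < p a}" using X by (rule finite_subset)
    moreover have "card (p ` {a. a < p a}) = card {a. a < p a}"
      by (rule card_image) (rule permutes_inj_on[OF p])
    ultimately show ?thesis unfolding fibre[OF p] by (intro eq) simp_all
  qed
  have "(\<Sum>l\<in>low ` ?Perm. \<Sum>q | q \<in> ?Perm \<and> low q = l. F (excedances q)) =
    (\<Sum>l\<in>low ` ?Perm. \<Sum>q | q \<in> ?Perm \<and> low q = l. G (excedances q))"
  proof (rule sum.cong[OF refl])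
    fix l assume "l \<in> low ` ?Perm"
    then obtain p where "p permutes X" "l = low p" by blast
    then show "(\<Sum>q | q \<in> ?Perm \<and> low q = l. F (excedances q)) =
      (\<Sum>q | q \<in> ?Perm \<and> low q = l. G (excedances q))"
      by (simp only: fibre_eq)
  qed
  then show ?thesis by (simp only: group[of F] group[of G])
qed

section \<open>The identity and the start of the run as keys\<close>

lemma source_key_id: "source_key (\<lambda>P a. a)"
  by unfold_locales auto

text \<open>
  For the ascents of a word this is the first entry of the run containing \<open>x\<close>
  (\<open>run_start_ascents\<close>); defining it from the arcs alone makes sense for every diagram.
\<close>

definition run_start :: "nat rel \<Rightarrow> nat \<Rightarrow> nat" where
  "run_start P x = (LEAST y. (y, x) \<in> P\<^sup>*)"

lemma rtrancl_increasing:
  fixes P :: "'a::order rel"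
  assumes "(x, y) \<in> P\<^sup>*" "\<forall>(a, b)\<in>P. a < b"
  shows "x \<le> y"
  using assms
proof (induction rule: rtrancl_induct)
  case (step y z)
  then have "x \<le> y" "y < z" by auto
  then show ?case by (simp add: order.strict_implies_order order.strict_trans1)
qed simp

text \<open>
  A path of increasing arcs that ends below \<open>t\<close> cannot use an arc with target \<open>t\<close>. Two numbers
  without outgoing arcs and with a common start lie on the same path, hence are equal.
\<close>

lemma source_key_run_start: "source_key run_start"
proof
  fix P :: "nat rel" and a s t :: nat
  assume inc: "\<forall>(a, b)\<in>P. a < b" and a: "a < t"
  have "(y, a) \<in> (insert (s, t) P)\<^sup>* \<longleftrightarrow> (y, a) \<in> P\<^sup>*" for y
  proof
    assume "(y, a) \<in> (insert (s, t) P)\<^sup>*"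
    then show "(y, a) \<in> P\<^sup>*"
    proof (induction rule: converse_rtrancl_induct)
      case (step y z)
      have "z \<le> a" by (rule rtrancl_increasing[OF step.IH inc])
      then have "(y, z) \<in> P" using step.hyps(1) a by auto
      then show ?case using step.IH by (rule converse_rtrancl_into_rtrancl)
    qed simp
  next
    assume "(y, a) \<in> P\<^sup>*"
    then show "(y, a) \<in> (insert (s, t) P)\<^sup>*" using rtrancl_mono[of P "insert (s, t) P"] by blast
  qed
  then show "run_start (insert (s, t) P) a = run_start P a" by (simp add: run_start_def)
next
  fix P :: "nat rel" assume sv: "single_valued P"
  show "inj_on (run_start P) (- Domain P)"
  proof (rule inj_onI)
    fix x y assume x: "x \<in> - Domain P" and y: "y \<in> - Domain P" and eq: "run_start P x = run_start P y"
    have start: "(run_start P z, z) \<in> P\<^sup>*" for z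
      unfolding run_start_def by (rule LeastI[of "\<lambda>y. (y, z) \<in> P\<^sup>*" z]) simp
    have "(x, y) \<in> P\<^sup>* \<or> (y, x) \<in> P\<^sup>*"
      using single_valued_confluent[OF sv start[of x], of y] start[of y] eq by simp
    then show "x = y"
    proof
      assume "(x, y) \<in> P\<^sup>*"
      then show ?thesis by (cases rule: converse_rtranclE) (use x in auto)
    next
      assume "(y, x) \<in> P\<^sup>*"
      then show ?thesis by (cases rule: converse_rtranclE) (use y in auto)
    qed
  qed
qed

section \<open>Invisible inversions\<close>

text \<open>
  Replacing \<open>j\<close> by its value \<open>c = p j\<close>: if \<open>(j, c)\<close> is an arc, the condition \<open>i < j\<close> is
  domination with respect to the identity key, and otherwise \<open>i < c \<le> j\<close> holds anyway.
\<close>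

lemma card_invisible_inversions:
  assumes p: "p permutes {1..n}"
  shows "card (invisible_inversions n p) = card (dominated_pairs (\<lambda>P a. a) (excedances p))"
proof -
  have "inj_on (\<lambda>(i, j). (i, p j)) (invisible_inversions n p)"
    by (rule inj_onI) (auto simp: inj_eq[OF permutes_inj[OF p]])
  moreover have "(\<lambda>(i, j). (i, p j)) ` invisible_inversions n p =
      dominated_pairs (\<lambda>P a. a) (excedances p)"
  proof (rule set_eqI, rule iffI)
    fix e assume "e \<in> (\<lambda>(i, j). (i, p j)) ` invisible_inversions n p"
    then obtain i j where e: "e = (i, p j)" and ij: "i < j" "p j < p i" "i < p j"
      by (auto simp: invisible_inversions_def)
    have "i < a'" if "p j = p a'" for a'
      using that permutes_inj[OF p] ij(1) by (simp add: inj_eq)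
    then show "e \<in> dominated_pairs (\<lambda>P a. a) (excedances p)"
      unfolding e using ij by (auto simp: dominated_pairs_def excedances_def)
  next
    fix e assume "e \<in> dominated_pairs (\<lambda>P a. a) (excedances p)"
    then obtain a c where e: "e = (a, c)" and ac: "a < c" "c < p a"
      and pre: "\<And>a'. c = p a' \<Longrightarrow> a' < c \<Longrightarrow> a < a'"
      by (auto simp: dominated_pairs_def excedances_def)
    have a: "a \<in> {1..n}" using permutes_not_in[OF p, of a] ac by force
    then have "p a \<in> {1..n}" using permutes_in_image[OF p] by blast
    then have c: "c \<in> {1..n}" using a ac by auto
    obtain j where j: "c = p j" using permutes_surj[OF p] by (metis surjD)
    then have "j \<in> {1..n}" using c permutes_in_image[OF p] by blast
    moreover have "a < j" using pre[OF j] ac(1) by (cases "j < c") auto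
    ultimately have "(a, j) \<in> invisible_inversions n p"
      using a j ac by (simp add: invisible_inversions_def)
    then show "e \<in> (\<lambda>(i, j). (i, p j)) ` invisible_inversions n p"
      using e j by force
  qed
  ultimately show ?thesis by (metis card_image)
qed

section \<open>Runs and occurrences of 13-2\<close>

lemma ascents_ascending_runs: "ascents w = (\<Union>r\<in>set (ascending_runs w). ascents r)"
proof (induction w rule: ascending_runs.induct)
  case (3 x y zs)
  obtain r rs where r: "ascending_runs (y # zs) = r # rs"
    by (cases "ascending_runs (y # zs)") auto
  then have "r \<noteq> []" "hd r = y"
    using hd_ascending_runs[of "y # zs"] by (simp_all del: ascending_runs.simps)
  moreover have "ascending_runs (x # y # zs) = (if x < y then (x # r) # rs else [x] # r # rs)"
    using r by (simp add: Let_def)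
  ultimately show ?case using 3 r by (auto simp: ascents_Cons[of x])
qed simp_all

lemma ascentE:
  assumes "(a, b) \<in> ascents w"
  obtains r where "r \<in> set (ascending_runs w)" "(a, b) \<in> ascents r" "a \<in> set r" "b \<in> set r"
proof -
  obtain r where r: "r \<in> set (ascending_runs w)" "(a, b) \<in> ascents r"
    using assms unfolding ascents_ascending_runs[of w] by (rule UN_E)
  show thesis
    by (rule that[OF r]) (use r(2) ascents_subset[of r] in blast)+
qed

lemma hd_reaches_run:
  "sorted_wrt (<) r \<Longrightarrow> x \<in> set r \<Longrightarrow> (hd r, x) \<in> (ascents r)\<^sup>*"
proof (induction r rule: ascents.induct)
  case (3 y z zs)
  show ?case
  proof (cases "x = y")
    case False
    then have "(z, x) \<in> (ascents (z # zs))\<^sup>*" using 3 by simp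
    then have "(z, x) \<in> (ascents (y # z # zs))\<^sup>*"
      using rtrancl_mono[of "ascents (z # zs)" "ascents (y # z # zs)"] by auto
    moreover have "(y, z) \<in> ascents (y # z # zs)" using 3 by simp
    ultimately show ?thesis by (simp del: ascents.simps add: converse_rtrancl_into_rtrancl)
  qed simp
qed simp_all

lemma hd_le_run: "sorted_wrt (<) r \<Longrightarrow> x \<in> set r \<Longrightarrow> hd r \<le> (x::'a::linorder)"
  by (cases r) auto

lemma ascending_runs_disjoint:
  assumes "distinct w" "r \<in> set (ascending_runs w)" "r' \<in> set (ascending_runs w)"
    "x \<in> set r" "x \<in> set r'"
  shows "r = r'"
  using assms distinct_concat_iff[of "ascending_runs w"] concat_ascending_runs[of w] by auto

text \<open>
  Arcs never leave a run, and within a run they form a path from its first entry.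
\<close>

lemma run_start_ascents:
  assumes w: "distinct w" and r: "r \<in> set (ascending_runs w)" and x: "x \<in> set r"
  shows "run_start (ascents w) x = hd r"
  unfolding run_start_def
proof (rule Least_equality)
  have inc: "sorted_wrt (<) r" using ascending_runs_increasing r by blast
  have "ascents r \<subseteq> ascents w" using ascents_ascending_runs[of w] r by blast
  then show "(hd r, x) \<in> (ascents w)\<^sup>*"
    using hd_reaches_run[OF inc x] rtrancl_mono by blast
  fix y assume "(y, x) \<in> (ascents w)\<^sup>*"
  then have "y \<in> set r"
  proof (induction rule: converse_rtrancl_induct)
    case (step y z)
    obtain r' where r': "r' \<in> set (ascending_runs w)" "y \<in> set r'" "z \<in> set r'"
      using step.hyps(1) by (rule ascentE)
    then show ?case using ascending_runs_disjoint[OF w r r'(1) step.IH r'(3)] by simp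
  qed (rule x)
  then show "hd r \<le> y" by (rule hd_le_run[OF inc])
qed

text \<open>
  Occurrences of 13-2, recorded by the values playing the roles of 1 and 2.
\<close>

definition pattern_values :: "nat list \<Rightarrow> (nat \<times> nat) set" where
  "pattern_values ys = {(ys ! i, ys ! j) | i j. i < j \<and> j < length ys \<and>
     ys ! i < ys ! j \<and> ys ! j < ys ! Suc i}"

text \<open>
  The value of \<open>pattern_values\<close> on the concatenation of runs with increasing first entries, written
  in terms of the set of runs alone; thus it can be computed from the runs before sorting.
\<close>

definition run_pairs :: "nat list set \<Rightarrow> (nat \<times> nat) set" where
  "run_pairs R = {(a, c). \<exists>r\<in>R. \<exists>r'\<in>R. hd r < hd r' \<and> c \<in> set r' \<and>
     (\<exists>b. (a, b) \<in> ascents r \<and> a < c \<and> c < b)}"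

lemma pattern_values_Cons:
  "pattern_values (x # ys) = {(x, c) | c. c \<in> set ys \<and> x < c \<and> c < hd ys} \<union> pattern_values ys"
  (is "?L = ?A \<union> ?B")
proof (intro equalityI subsetI)
  fix e assume "e \<in> ?L"
  then obtain i j where e: "e = ((x # ys) ! i, (x # ys) ! j)" and ij: "i < j" "j < Suc (length ys)"
    "(x # ys) ! i < (x # ys) ! j" "(x # ys) ! j < (x # ys) ! Suc i"
    by (auto simp: pattern_values_def)
  then obtain j' where j: "j = Suc j'" by (cases j) auto
  show "e \<in> ?A \<union> ?B"
  proof (cases i)
    case 0
    have "ys \<noteq> []" "ys ! j' \<in> set ys" using ij j by auto
    then have "e \<in> ?A" using 0 e ij j by (simp add: hd_conv_nth)
    then show ?thesis ..
  next
    case (Suc i')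
    then have "e \<in> ?B" using e ij j by (auto simp: pattern_values_def)
    then show ?thesis ..
  qed
next
  fix e assume "e \<in> ?A \<union> ?B"
  then show "e \<in> ?L"
  proof
    assume "e \<in> ?A"
    then obtain j where j: "j < length ys" "e = (x, ys ! j)" "x < ys ! j" "ys ! j < hd ys"
      by (auto simp: in_set_conv_nth)
    then show ?thesis
      unfolding pattern_values_def
      by - (rule CollectI, rule exI[of _ 0], rule exI[of _ "Suc j"], cases ys, simp_all)
  next
    assume "e \<in> ?B"
    then obtain i j where "e = (ys ! i, ys ! j)" "i < j" "j < length ys"
      "ys ! i < ys ! j" "ys ! j < ys ! Suc i"
      by (auto simp: pattern_values_def)
    then show ?thesis
      unfolding pattern_values_def by - (rule CollectI, rule exI[of _ "Suc i"], rule exI[of _ "Suc j"], simp)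
  qed
qed

text \<open>
  A 3 that begins a later run cannot be followed by a smaller 2, because this run begins with the
  least of the remaining entries. Hence the 1 and the 3 lie in one run, and by monotonicity the 2
  lies outside of it.
\<close>

lemma pattern_values_run:
  assumes "sorted_wrt (<) r" "r \<noteq> []" "\<forall>c\<in>set ys. hd ys \<le> c"
  shows "pattern_values (r @ ys) =
    {(a, c). c \<in> set ys \<and> (\<exists>b. (a, b) \<in> ascents r \<and> a < c \<and> c < b)} \<union> pattern_values ys"
  using assms
proof (induction r)
  case (Cons x r)
  show ?case
  proof (cases "r = []")
    case True
    then show ?thesis using Cons.prems(3) by (auto simp: pattern_values_Cons[of x ys])
  next
    case False
    have "x < hd r" "\<forall>c\<in>set r. hd r \<le> c"
      using Cons.prems False hd_le_run[of r] by auto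
    then show ?thesis
      using Cons False by (auto simp: pattern_values_Cons[of x] ascents_Cons[of x])
  qed
qed simp

text \<open>
  With first entries in increasing order, the runs following \<open>r\<close> are those that start with a
  greater number than \<open>r\<close>.
\<close>

lemma pattern_values_concat:
  assumes "\<forall>r\<in>set rs. r \<noteq> [] \<and> sorted_wrt (<) r" "sorted_wrt (<) (map hd rs)"
  shows "pattern_values (concat rs) = run_pairs (set rs)"
  using assms
proof (induction rs)
  case Nil
  then show ?case by (simp add: pattern_values_def run_pairs_def)
next
  case (Cons r rs)
  have min: "hd (concat rs) \<le> c" if c: "c \<in> set (concat rs)" for c
  proof -
    obtain r' where r': "r' \<in> set rs" "c \<in> set r'" using c by auto
    obtain r0 rs0 where rs: "rs = r0 # rs0" using r'(1) by (cases rs) auto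
    have "r0 \<noteq> []" using Cons.prems(1) rs by simp
    then have "hd (concat rs) = hd r0" using rs by simp
    also have "\<dots> \<le> hd r'" using Cons.prems(2) rs r'(1) by auto
    also have "\<dots> \<le> c" using Cons.prems(1) r' by (intro hd_le_run) auto
    finally show ?thesis .
  qed
  have "pattern_values (concat (r # rs)) =
    {(a, c). c \<in> set (concat rs) \<and> (\<exists>b. (a, b) \<in> ascents r \<and> a < c \<and> c < b)} \<union> run_pairs (set rs)"
    using pattern_values_run[of r "concat rs"] Cons min by simp
  also have "\<dots> = run_pairs (set (r # rs))"
  proof -
    have hd: "hd r < hd r'" if "r' \<in> set rs" for r' using Cons.prems(2) that by simp
    then have "\<not> hd r' < hd r" if "r' \<in> set rs" for r' using that by (meson less_asym)
    then show ?thesis using hd unfolding run_pairs_def by fastforce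
  qed
  finally show ?case .
qed

lemma pattern_values_runsort_list:
  assumes "distinct w"
  shows "pattern_values (runsort_list w) = run_pairs (set (ascending_runs w))"
proof -
  let ?rs = "ascending_runs w"
  let ?k = "\<lambda>r. Min (set r)"
  have inc: "\<forall>r\<in>set ?rs. r \<noteq> [] \<and> sorted_wrt (<) r" by (rule ascending_runs_increasing)
  have "?k r = hd r" if "r \<in> set ?rs" for r
    using inc that hd_le_run[of r] by (intro Min_eqI) auto
  then have Min: "map ?k (sort_key ?k ?rs) = map hd (sort_key ?k ?rs)" by simp
  have "removeAll [] ?rs = ?rs" using inc by (intro removeAll_id) auto
  then have "distinct ?rs"
    using assms distinct_concat_iff[of ?rs] concat_ascending_runs[of w] by auto
  moreover have "inj_on hd (set ?rs)"
    using ascending_runs_disjoint[OF assms] inc by (intro inj_onI) (metis hd_in_set)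
  ultimately have "distinct (map hd (sort_key ?k ?rs))" by (simp add: distinct_map)
  moreover have "sorted (map hd (sort_key ?k ?rs))" using sorted_sort_key[of ?k ?rs] Min by simp
  ultimately have "sorted_wrt (<) (map hd (sort_key ?k ?rs))" by (simp add: strict_sorted_iff)
  then show ?thesis
    unfolding runsort_list_def using inc by (subst pattern_values_concat) auto
qed

text \<open>
  If no arc arrives at \<open>c\<close>, then \<open>c\<close> starts its run, so \<open>c > a\<close> already implies that the run of
  \<open>c\<close> starts with a greater number than the run of \<open>a\<close>. That the letters form an interval
  ensures that every value between those of an ascent occurs in the word.
\<close>

lemma run_pairs_eq_dominated_pairs:
  assumes w: "w \<in> permutations_of_set {1..n}"
  shows "run_pairs (set (ascending_runs w)) = dominated_pairs run_start (ascents w)"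
proof (rule set_eqI, clarify)
  have dw: "distinct w" and sw: "set w = {1..n}" using w by (auto simp: permutations_of_set_def)
  let ?R = "set (ascending_runs w)"
  have run_of: "\<exists>r\<in>?R. x \<in> set r" if "x \<in> set w" for x
    using that arg_cong[OF concat_ascending_runs[of w], of set] by auto
  fix a c
  show "(a, c) \<in> run_pairs ?R \<longleftrightarrow> (a, c) \<in> dominated_pairs run_start (ascents w)"
  proof
    assume "(a, c) \<in> run_pairs ?R"
    then obtain r r' b where r: "r \<in> ?R" "(a, b) \<in> ascents r" and r': "r' \<in> ?R" "c \<in> set r'"
      and ord: "hd r < hd r'" "a < c" "c < b"
      by (auto simp: run_pairs_def)
    have "(a, b) \<in> ascents w" using r ascents_ascending_runs[of w] by blast
    moreover have "a \<in> set r" using r(2) ascents_subset[of r] by blast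
    then have "run_start (ascents w) a = hd r" by (rule run_start_ascents[OF dw r(1)])
    moreover have "run_start (ascents w) a' = hd r'" if arc: "(a', c) \<in> ascents w" for a'
    proof -
      obtain r'' where r'': "r'' \<in> ?R" "a' \<in> set r''" "c \<in> set r''"
        using arc by (rule ascentE)
      then have "a' \<in> set r'" using ascending_runs_disjoint[OF dw r''(1) r'(1) r''(3) r'(2)] by simp
      then show ?thesis by (rule run_start_ascents[OF dw r'(1)])
    qed
    ultimately show "(a, c) \<in> dominated_pairs run_start (ascents w)"
      using ord unfolding dominated_pairs_def by auto
  next
    assume "(a, c) \<in> dominated_pairs run_start (ascents w)"
    then obtain b where ab: "(a, b) \<in> ascents w" and ord: "a < c" "c < b"
      and pre: "\<And>a'. (a', c) \<in> ascents w \<Longrightarrow> run_start (ascents w) a < run_start (ascents w) a'"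
      by (auto simp: dominated_pairs_def)
    obtain r where r: "r \<in> ?R" "(a, b) \<in> ascents r" and ar: "a \<in> set r"
      using ab by (rule ascentE)
    have "c \<in> set w" using ascents_subset[of w] ab ord sw by auto
    then obtain r' where r': "r' \<in> ?R" "c \<in> set r'" using run_of by blast
    have inc: "sorted_wrt (<) r" "sorted_wrt (<) r'" using ascending_runs_increasing r r' by blast+
    have "hd r < hd r'"
    proof (cases "c = hd r'")
      case True
      then show ?thesis using hd_le_run[OF inc(1) ar] ord(1) by simp
    next
      case False
      obtain a' where a': "(a', c) \<in> ascents r'"
        using hd_reaches_run[OF inc(2) r'(2)] by (cases rule: rtranclE) (use False in auto)
      then have "a' \<in> set r'" "(a', c) \<in> ascents w"
        using ascents_subset[of r'] ascents_ascending_runs[of w] r' by blast+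
      then show ?thesis
        using pre[of a'] run_start_ascents[OF dw r(1) ar] run_start_ascents[OF dw r'(1)] by simp
    qed
    then show "(a, c) \<in> run_pairs ?R"
      using r r' ord by (auto simp: run_pairs_def)
  qed
qed

lemma bij_betw_one_line:
  "bij_betw (one_line n) {p. p permutes {1..n}} (permutations_of_set {1..n})"
proof -
  let ?Perm = "{p. p permutes {1..n}}"
  have "inj_on (one_line n) ?Perm"
  proof (rule inj_onI)
    fix p q assume p: "p \<in> ?Perm" and q: "q \<in> ?Perm" and eq: "one_line n p = one_line n q"
    show "p = q"
    proof
      fix a
      show "p a = q a"
      proof (cases "a \<in> {1..n}")
        case True
        then show ?thesis using eq by (auto simp: one_line_def simp del: upt_Suc)
      next
        case False
        then show ?thesis using p q by (simp add: permutes_not_in)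
      qed
    qed
  qed
  moreover have "one_line n ` ?Perm \<subseteq> permutations_of_set {1..n}"
  proof (rule image_subsetI)
    fix p assume p: "p \<in> ?Perm"
    have "{1..<Suc n} = {1..n}" by auto
    then show "one_line n p \<in> permutations_of_set {1..n}"
      using p permutes_image[of p "{1..n}"] permutes_inj_on[of p "{1..n}" "{1..n}"]
      by (simp add: one_line_def permutations_of_set_def distinct_map del: upt_Suc)
  qed
  moreover have "card ?Perm = card (permutations_of_set {1..n})"
    using card_permutations[of "{1..n}" n] by simp
  ultimately show ?thesis
    unfolding bij_betw_def
    using card_subset_eq[of "permutations_of_set {1..n}" "one_line n ` ?Perm"] card_image[of "one_line n" ?Perm]
    by simp
qed

lemma card_occurrences_13_2_runsort:
  assumes p: "p permutes {1..n}"
  shows "card (occurrences_13_2 n (runsort n p)) =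
    card (dominated_pairs run_start (ascents (one_line n p)))"
proof -
  let ?w = "one_line n p"
  let ?ys = "runsort_list ?w"
  have w: "?w \<in> permutations_of_set {1..n}"
    using bij_betw_apply[OF bij_betw_one_line] p by blast
  then have dw: "distinct ?w" by (simp add: permutations_of_set_def)
  have len: "length ?ys = n" using mset_eq_length[OF mset_runsort_list, of ?w] by (simp add: one_line_def)
  have dys: "distinct ?ys" using mset_eq_imp_distinct_iff[OF mset_runsort_list] dw by blast
  let ?f = "\<lambda>(i, j). (?ys ! (i - 1), ?ys ! (j - 1))"
  have occ: "occurrences_13_2 n (runsort n p) = {(i, j). 1 \<le> i \<and> i < j \<and> j \<le> n \<and>
      ?ys ! (i - 1) < ?ys ! (j - 1) \<and> ?ys ! (j - 1) < ?ys ! i}"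
    by (auto simp: occurrences_13_2_def runsort_def)
  have "inj_on ?f (occurrences_13_2 n (runsort n p))"
    unfolding occ using dys len by (auto simp: inj_on_def nth_eq_iff_index_eq)
  moreover have "?f ` occurrences_13_2 n (runsort n p) = pattern_values ?ys"
  proof (intro equalityI subsetI)
    fix e assume "e \<in> ?f ` occurrences_13_2 n (runsort n p)"
    then obtain i j where e: "e = (?ys ! (i - 1), ?ys ! (j - 1))" and ij: "1 \<le> i" "i < j" "j \<le> n"
      "?ys ! (i - 1) < ?ys ! (j - 1)" "?ys ! (j - 1) < ?ys ! i"
      unfolding occ by auto
    then show "e \<in> pattern_values ?ys"
      unfolding pattern_values_def using len
      by - (rule CollectI, rule exI[of _ "i - 1"], rule exI[of _ "j - 1"], auto)
  next
    fix e assume "e \<in> pattern_values ?ys"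
    then obtain i j where e: "e = (?ys ! i, ?ys ! j)" and ij: "i < j" "j < n"
      "?ys ! i < ?ys ! j" "?ys ! j < ?ys ! Suc i"
      unfolding pattern_values_def using len by auto
    then have "(Suc i, Suc j) \<in> occurrences_13_2 n (runsort n p)" unfolding occ by auto
    then show "e \<in> ?f ` occurrences_13_2 n (runsort n p)"
      using e by (intro image_eqI[of _ _ "(Suc i, Suc j)"]) simp_all
  qed
  ultimately have "card (occurrences_13_2 n (runsort n p)) = card (pattern_values ?ys)"
    by (metis card_image)
  then show ?thesis
    using pattern_values_runsort_list[OF dw] run_pairs_eq_dominated_pairs[OF w] by simp
qed

theorem mainTheorem2:
  fixes n :: nat
  assumes "n \<ge> 1"
  shows "(\<Sum>p | p permutes {1..n}. monom (1::int) (card (invisible_inversions n p))) =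
         (\<Sum>p | p permutes {1..n}. monom (1::int) (card (occurrences_13_2 n (runsort n p))))"
proof -
  let ?Perm = "{p. p permutes {1..n}}"
  let ?weight = "\<lambda>key P. monom (1::int) (card (dominated_pairs key P))"
  have "(\<Sum>p\<in>?Perm. monom (1::int) (card (invisible_inversions n p))) =
        (\<Sum>p\<in>?Perm. ?weight (\<lambda>P a. a) (excedances p))"
    by (rule sum.cong) (simp_all add: card_invisible_inversions)
  also have "\<dots> = (\<Sum>p\<in>?Perm. ?weight run_start (excedances p))"
    by (rule sum_excedances_cong)
       (simp_all add: sum_dominated_pairs_key_cong[OF source_key_id source_key_run_start])
  also have "\<dots> = (\<Sum>w\<in>permutations_of_set {1..n}. ?weight run_start (ascents w))"
    by (rule sum_ascents_eq_sum_excedances[symmetric]) simp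
  also have "\<dots> = (\<Sum>p\<in>?Perm. ?weight run_start (ascents (one_line n p)))"
    by (rule sum.reindex_bij_betw[OF bij_betw_one_line, symmetric])
  also have "\<dots> = (\<Sum>p\<in>?Perm. monom 1 (card (occurrences_13_2 n (runsort n p))))"
    by (rule sum.cong) (simp_all add: card_occurrences_13_2_runsort)
  finally show ?thesis .
qed

end
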